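(* Let $G$ and $H$ be archimedean unital $f$-rings with unit elements $e_G$ and $e_H$ respectively, and let $K$ be an archimedean $f$-ring. Let $\mathfrak{b}: G\times H\to K$ be a positive biadditive map, i.e. $\mathfrak{b}$ is additive in each variable and $\mathfrak{b}(a,b)\ge 0$ whenever $0\le a\in G$ and $0\le b\in H$. The following conditions are equivalent: (i) $\mathfrak{b}$ is multiplicative, i.e. $\mathfrak{b}(ac,bd)=\mathfrak{b}(a,b)\,\mathfrak{b}(c,d)$ for all $a,c\in G$ and $b,d\in H$. (ii) $\mathfrak{b}$ is an $\ell$-bimorphism and $\mathfrak{b}(e_G,e_H)$ is idempotent, i.e. $\mathfrak{b}(e_G,e_H)^2=\mathfrak{b}(e_G,e_H)$.
   Context: An $f$-ring is an (associative) lattice-ordered ring (a ring whose additive group is a lattice-ordered group and in which products of positive elements are positive) such that $a\wedge b=0$ and $c\ge 0$ imply $(ac)\wedge b=(ca)\wedge b=0$; it need not have a unit or be reduced. It is unital if it has a multiplicative unit. It is archimedean if $a,b\ge 0$ and $na\le b$ for all $n\in\mathbb{N}$ imply $a=0$. A biadditive map $\mathfrak{b}:G\times H\to K$ is an $\ell$-bimorphism if for every $0\le a\in G$ the map $h\mapsto \mathfrak{b}(a,h)$ from $H$ to $K$, and for every $0\le b\in H$ the map $g\mapsto\mathfrak{b}(g,b)$ from $G$ to $K$, are lattice homomorphisms. *)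

theory Defs
  imports "HOL-Library.Lattice_Algebras"
begin

text \<open>Neither commutativity nor a unit nor reducedness is assumed.\<close>

class f_ring = lattice_ring +
  assumes f_ring_right: "inf a b = 0 \<Longrightarrow> 0 \<le> c \<Longrightarrow> inf (a * c) b = 0"
    and f_ring_left: "inf a b = 0 \<Longrightarrow> 0 \<le> c \<Longrightarrow> inf (c * a) b = 0"

text \<open>Built on \<^class>\<open>monoid_mult\<close> rather than \<^class>\<open>ring_1\<close>, so the trivial ring,
  in which \<open>0 = 1\<close>, is a unital f-ring.\<close>

class unital_f_ring = f_ring + monoid_mult

text \<open>The sum is the \<open>n\<close>-fold multiple \<open>n a\<close>; \<open>of_nat\<close> would need a unit.\<close>

class archimedean_f_ring = f_ring +
  assumes archimedean: "0 \<le> a \<Longrightarrow> 0 \<le> b \<Longrightarrow> \<forall>n::nat. (\<Sum>i<n. a) \<le> b \<Longrightarrow> a = 0"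

definition lattice_hom :: "('a::lattice \<Rightarrow> 'b::lattice) \<Rightarrow> bool" where
  "lattice_hom f \<longleftrightarrow>
    (\<forall>x y. f (inf x y) = inf (f x) (f y)) \<and> (\<forall>x y. f (sup x y) = sup (f x) (f y))"

definition biadditive ::
  "('g::ab_group_add \<Rightarrow> 'h::ab_group_add \<Rightarrow> 'k::ab_group_add) \<Rightarrow> bool" where
  "biadditive b \<longleftrightarrow> (\<forall>h. additive (\<lambda>g. b g h)) \<and> (\<forall>g. additive (\<lambda>h. b g h))"

definition l_bimorphism ::
  "('g::lattice_ab_group_add \<Rightarrow> 'h::lattice_ab_group_add \<Rightarrow> 'k::lattice_ab_group_add) \<Rightarrow> bool" where
  "l_bimorphism b \<longleftrightarrow> biadditive b \<and>
    (\<forall>g\<ge>0. lattice_hom (\<lambda>h. b g h)) \<and> (\<forall>h\<ge>0. lattice_hom (\<lambda>g. b g h))"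

end

theory Submission
  imports Defs
begin

text \<open>
  Call two positive elements disjoint if their infimum is \<open>0\<close>.  An additive map is a lattice
  homomorphism as soon as it preserves disjointness, so both conditions of the theorem can be
  discussed in terms of disjoint elements.

  For (i) \<open>\<Longrightarrow>\<close> (ii), disjoint elements of an f-ring have product \<open>0\<close>.  If \<open>x\<close> and \<open>y\<close> are
  disjoint and \<open>g \<ge> 0\<close>, multiplicativity gives \<open>b g x * b g y = b (g * g) (x * y) = 0\<close>, so
  \<open>u = inf (b g x) (b g y)\<close> has square \<open>0\<close>.  This does not by itself make \<open>u\<close> vanish, because
  \<open>'k\<close> may have nilpotent elements.  But \<open>e = b 1 1\<close> acts as a unit on the range of \<open>b\<close> and
  hence on \<open>u\<close>, whereas in an archimedean f-ring every positive element of square \<open>0\<close>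
  annihilates all positive elements (\<open>square_zero_annihilates\<close>).  Hence \<open>u = u * e = 0\<close>.

  For (ii) \<open>\<Longrightarrow>\<close> (i), the key is a rigidity principle (\<open>hom_determined_by_unit\<close>): let \<open>S\<close> and
  \<open>T\<close> be additive lattice homomorphisms from a unital f-ring into an archimedean f-ring such
  that \<open>S x\<close> and \<open>T y\<close> are disjoint whenever \<open>x\<close> and \<open>y\<close> are.  If \<open>S\<close> and \<open>T\<close> agree at the
  unit, they agree everywhere.  Heuristically, \<open>S\<close> and \<open>T\<close> are weighted compositions
  \<open>a \<mapsto> w * (a \<circ> \<phi>)\<close>; the disjointness assumption says that both use the same \<open>\<phi>\<close>, and the
  value at the unit is the weight.

  By biadditivity it suffices to prove \<open>b (a * c) (x * y) = b a x * b c y\<close> for positive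
  arguments.  As functions of \<open>a\<close> alone, the two sides are lattice homomorphisms that satisfy
  the disjointness assumption, since in an f-ring multiplication by a positive element
  preserves disjointness.  So \<open>a\<close> may be replaced by the unit.  The same reasoning then replaces
  \<open>x\<close>, \<open>c\<close> and \<open>y\<close> by the unit, and what remains is exactly \<open>b 1 1 = b 1 1 * b 1 1\<close>.
\<close>

section \<open>Lattice-ordered groups\<close>

text \<open>Positive parts are handled below as differences \<open>a - inf a b\<close>, which these rewrite
  rules would destroy.\<close>

declare neg_inf_eq_sup [simp del] and diff_inf_eq_sup [simp del]

primrec multiple :: "nat \<Rightarrow> 'a::ab_group_add \<Rightarrow> 'a" (infixr "\<cdot>" 75) where
  "0 \<cdot> a = 0"
| "Suc n \<cdot> a = a + n \<cdot> a"

lemma multiple_eq_sum: "n \<cdot> a = (\<Sum>i<n. a)"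
  by (induction n) (simp_all add: add.commute)

lemma multiple_nonneg: "0 \<le> a \<Longrightarrow> 0 \<le> n \<cdot> a" for a :: "'a::ordered_ab_group_add"
  by (induction n) simp_all

lemma multiple_mono: "a \<le> b \<Longrightarrow> n \<cdot> a \<le> n \<cdot> b" for a :: "'a::ordered_ab_group_add"
  by (induction n) (simp_all add: add_mono)

lemma multiple_diff: "n \<cdot> (a - b) = n \<cdot> a - n \<cdot> b"
  by (induction n) (simp_all add: algebra_simps)

lemma multiple_add_left: "(m + n) \<cdot> a = m \<cdot> a + n \<cdot> a"
  by (induction m) (simp_all add: algebra_simps)

lemma multiple_multiple: "m \<cdot> n \<cdot> a = (m * n) \<cdot> a"
  by (induction m) (simp_all add: multiple_add_left)

lemma multiple_mult_left: "n \<cdot> a * b = n \<cdot> (a * b)" for a :: "'a::ring"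
  by (induction n) (simp_all add: algebra_simps)

lemma additive_multiple: "additive f \<Longrightarrow> f (n \<cdot> a) = n \<cdot> f a"
  by (induction n) (simp_all add: additive.zero additive.add)

text \<open>The multiples of \<open>pprt x\<close> are the suprema of the multiples \<open>i \<cdot> x\<close> with \<open>i \<le> n\<close>; only
  the upper bound is stated.\<close>

lemma multiple_pprt_le:
  fixes x :: "'a::lattice_ab_group_add"
  assumes "\<And>i. i \<le> n \<Longrightarrow> i \<cdot> x \<le> w"
  shows "n \<cdot> pprt x \<le> w"
  using assms
proof (induction n arbitrary: w)
  case 0
  then show ?case by simp
next
  case (Suc n)
  have "i \<cdot> x \<le> w - x" if "i \<le> n" for i
    using Suc.prems[of "Suc i"] that by (simp add: algebra_simps)
  then have "n \<cdot> pprt x \<le> w - x"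
    by (rule Suc.IH)
  moreover have "n \<cdot> pprt x \<le> w"
    using Suc.prems by (intro Suc.IH) simp
  ultimately have "pprt x \<le> w - n \<cdot> pprt x"
    unfolding pprt_def[of x] by (intro le_supI) (simp_all add: algebra_simps)
  then show ?case
    by (simp add: le_diff_eq)
qed

lemma pprt_diff_eq: "pprt (a - b) = a - inf a b" for a :: "'a::lattice_ab_group_add"
proof -
  have "a - inf a b = sup 0 (a - b)"
    by (simp add: diff_inf_eq_sup add_sup_distrib_left)
  then show ?thesis
    by (simp add: pprt_def sup_commute)
qed

lemma inf_diff_distrib: "inf a b - c = inf (a - c) (b - c)"
  for a :: "'a::lattice_ab_group_add"
  using add_inf_distrib_right[of a b "- c"] by simp

lemma pprt_diff_disjoint: "inf (pprt (a - b)) (pprt (b - a)) = 0"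
  for a :: "'a::lattice_ab_group_add"
proof -
  have "inf (a - inf a b) (b - inf a b) = inf a b - inf a b"
    by (rule inf_diff_distrib[symmetric])
  then show ?thesis
    by (simp add: pprt_diff_eq inf_commute)
qed

lemma diff_eq_pprt_diff: "a - b = pprt (a - b) - pprt (b - a)"
  for a :: "'a::lattice_ab_group_add"
  by (simp add: pprt_diff_eq inf_commute)

lemma inf_add_le_of_disjoint:
  fixes x y z :: "'a::lattice_ab_group_add"
  assumes "inf x z = 0" "0 \<le> y"
  shows "inf (x + y) z \<le> y"
proof -
  have "inf (x + y) z - y \<le> x"
    by (simp add: diff_le_eq)
  moreover have "inf (x + y) z - y \<le> z"
    using assms(2) by (simp add: diff_le_eq le_infI2 add_increasing2)
  ultimately have "inf (x + y) z - y \<le> inf x z"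
    by (rule le_infI)
  then show ?thesis
    using assms(1) by simp
qed

lemma disjoint_mono:
  fixes x y :: "'a::lattice_ab_group_add"
  assumes "inf x' y' = 0" "0 \<le> x" "x \<le> x'" "0 \<le> y" "y \<le> y'"
  shows "inf x y = 0"
  using inf_mono[OF assms(3,5)] assms by (simp add: order.antisym)

lemma disjoint_multiple:
  fixes x y :: "'a::lattice_ab_group_add"
  assumes "inf x y = 0"
  shows "inf x (n \<cdot> y) = 0"
proof (induction n)
  case 0
  have "0 \<le> x" using assms inf_le1 by metis
  then show ?case by (simp add: inf_absorb2)
next
  case (Suc n)
  have nonneg: "0 \<le> x" "0 \<le> y" using assms inf_le1 inf_le2 by metis+
  have "inf (y + n \<cdot> y) x \<le> n \<cdot> y"
    using assms nonneg by (intro inf_add_le_of_disjoint) (simp_all add: inf_commute multiple_nonneg)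
  then have "inf x (Suc n \<cdot> y) \<le> inf x (n \<cdot> y)"
    by (simp add: inf_commute)
  then show ?case
    using Suc nonneg by (simp add: order.antisym multiple_nonneg)
qed

text \<open>Think of \<open>\<alpha>\<close>, \<open>\<beta>\<close> and \<open>w\<close> as functions.  The separation assumption says that nowhere
  does a multiple \<open>k \<cdot> w\<close> lie strictly between \<open>\<beta>\<close> and \<open>\<alpha>\<close>.  Where \<open>\<alpha> > \<beta> + w\<close> there would be
  such a multiple, namely the first one above \<open>\<beta>\<close>.  The order-theoretic proof
  climbs instead: by induction on \<open>k\<close>, the multiple \<open>k \<cdot> w\<close> does not exceed \<open>\<beta>\<close> on the support
  of \<open>\<gamma> = pprt (\<alpha> - \<beta> - w)\<close>.  As \<open>\<beta>\<close> is bounded by a multiple of \<open>w\<close>, this makes \<open>\<gamma>\<close> disjoint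
  from \<open>w\<close>; but \<open>\<gamma>\<close> is also bounded by a multiple of \<open>w\<close>, hence \<open>\<gamma> = 0\<close>.\<close>

lemma close_if_no_multiple_between:
  fixes \<alpha> \<beta> w :: "'a::lattice_ab_group_add"
  assumes w: "0 \<le> w" and \<beta>: "0 \<le> \<beta>" "\<beta> \<le> m \<cdot> w" and \<alpha>: "\<alpha> \<le> m \<cdot> w"
    and separated: "\<And>k. inf (pprt (\<alpha> - k \<cdot> w)) (pprt (k \<cdot> w - \<beta>)) = 0"
  shows "\<alpha> - \<beta> \<le> w"
proof -
  define \<gamma> where "\<gamma> = pprt (\<alpha> - \<beta> - w)"
  have \<gamma>: "0 \<le> \<gamma>" by (simp add: \<gamma>_def)
  have climb: "inf \<gamma> (pprt (k \<cdot> w - \<beta>)) = 0" for k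
  proof (induction k)
    case 0
    show ?case using \<beta> \<gamma> by (simp add: inf_absorb2)
  next
    case (Suc k)
    define p q r where "p = pprt (\<alpha> - Suc k \<cdot> w)" and "q = pprt (k \<cdot> w - \<beta>)"
      and "r = pprt (Suc k \<cdot> w - \<beta>)"
    have "\<alpha> - \<beta> - w = (\<alpha> - Suc k \<cdot> w) + (k \<cdot> w - \<beta>)"
      by (simp add: algebra_simps)
    also have "\<dots> \<le> p + q"
      by (intro add_mono) (simp_all add: p_def q_def pprt_def)
    finally have "\<gamma> \<le> p + q"
      by (simp add: \<gamma>_def pprt_def[of "\<alpha> - \<beta> - w"] p_def q_def)
    then have "inf \<gamma> r \<le> inf (p + q) r"
      by (intro inf_mono) simp_all
    also have "\<dots> \<le> q"
      using separated[of "Suc k"] by (intro inf_add_le_of_disjoint) (simp_all add: p_def q_def r_def)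
    finally have "inf \<gamma> r \<le> inf \<gamma> q" by simp
    moreover have "0 \<le> inf \<gamma> r" using \<gamma> by (simp add: r_def)
    ultimately show ?case
      using Suc by (simp add: q_def r_def order.antisym)
  qed
  have "w \<le> Suc m \<cdot> w - \<beta>"
    using \<beta>(2) by simp
  then have "w \<le> pprt (Suc m \<cdot> w - \<beta>)"
    by (simp add: pprt_def le_supI1)
  then have "inf \<gamma> w = 0"
    using disjoint_mono[OF climb[of "Suc m"]] w \<gamma> by simp
  then have "inf \<gamma> (m \<cdot> w) = 0"
    by (rule disjoint_multiple)
  moreover have "\<gamma> \<le> m \<cdot> w"
  proof -
    have "\<alpha> - \<beta> - w \<le> \<alpha> - 0 - 0"
      using \<beta>(1) w by (intro diff_mono) simp_all
    then have "\<alpha> - \<beta> - w \<le> m \<cdot> w"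
      using \<alpha> by (metis diff_zero order_trans)
    then show ?thesis
      using w by (simp add: \<gamma>_def pprt_def multiple_nonneg)
  qed
  ultimately have "pprt (\<alpha> - \<beta> - w) = 0"
    by (simp add: \<gamma>_def inf_absorb1)
  then show ?thesis
    by (simp add: le_zero_iff_zero_pprt[symmetric])
qed

section \<open>Additive lattice homomorphisms\<close>

text \<open>Subtracting \<open>inf x y\<close> turns any \<open>x\<close> and \<open>y\<close> into a disjoint pair.\<close>

lemma lattice_homI_disjoint:
  fixes f :: "'a::lattice_ab_group_add \<Rightarrow> 'b::lattice_ab_group_add"
  assumes "additive f" and "\<And>x y. inf x y = 0 \<Longrightarrow> inf (f x) (f y) = 0"
  shows "lattice_hom f"
proof -
  interpret additive f by fact
  have inf: "f (inf x y) = inf (f x) (f y)" for x y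
  proof -
    define m where "m = inf x y"
    have "inf (x - m) (y - m) = 0"
      by (simp add: m_def flip: inf_diff_distrib)
    then have "inf (f x - f m) (f y - f m) = 0"
      using assms(2) by (simp flip: diff)
    then have "inf (f x) (f y) - f m = 0"
      by (simp add: inf_diff_distrib)
    then show ?thesis by (simp add: m_def)
  qed
  moreover have "f (sup x y) = sup (f x) (f y)" for x y
  proof -
    have "f (sup x y) + f (inf x y) = sup (f x) (f y) + inf (f x) (f y)"
      by (simp flip: add add_eq_inf_sup)
    then show ?thesis by (simp add: inf)
  qed
  ultimately show ?thesis by (simp add: lattice_hom_def)
qed

lemma lattice_hom_disjoint:
  fixes f :: "'a::lattice_ab_group_add \<Rightarrow> 'b::lattice_ab_group_add"
  assumes "additive f" "lattice_hom f" "inf x y = 0"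
  shows "inf (f x) (f y) = 0"
  using assms by (metis additive.zero lattice_hom_def)

lemma lattice_hom_pprt:
  assumes "additive f" "lattice_hom f"
  shows "f (pprt x) = pprt (f x)"
  using assms by (simp add: pprt_def lattice_hom_def additive.zero)

lemma lattice_hom_nonneg:
  fixes f :: "'a::lattice_ab_group_add \<Rightarrow> 'b::lattice_ab_group_add"
  assumes "additive f" "lattice_hom f" "0 \<le> x"
  shows "0 \<le> f x"
  using lattice_hom_pprt[OF assms(1,2), of x] assms(3) by (metis pprt_eq_id zero_le_pprt)

lemma lattice_hom_mono:
  fixes f :: "'a::lattice_ab_group_add \<Rightarrow> 'b::lattice_ab_group_add"
  assumes "additive f" "lattice_hom f" "x \<le> y"
  shows "f x \<le> f y"
  using lattice_hom_nonneg[OF assms(1,2), of "y - x"] assms(1,3) by (simp add: additive.diff)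

lemma additive_eqI_nonneg:
  fixes f g :: "'a::lattice_ab_group_add \<Rightarrow> 'b::ab_group_add"
  assumes "additive f" "additive g" "\<And>x. 0 \<le> x \<Longrightarrow> f x = g x"
  shows "f x = g x"
proof -
  have "f (pprt x - pprt (- x)) = g (pprt x - pprt (- x))"
    using assms by (simp add: additive.diff)
  then show ?thesis
    using diff_eq_pprt_diff[of x 0] by simp
qed

lemma additive_comp: "additive f \<Longrightarrow> additive g \<Longrightarrow> additive (\<lambda>x. f (g x))"
  by (simp add: additive_def)

lemma lattice_hom_comp: "lattice_hom f \<Longrightarrow> lattice_hom g \<Longrightarrow> lattice_hom (\<lambda>x. f (g x))"
  by (simp add: lattice_hom_def)

section \<open>Archimedean f-rings\<close>

lemma additive_mult_left: "additive (\<lambda>x::'a::ring. c * x)"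
  and additive_mult_right: "additive (\<lambda>x::'a::ring. x * c)"
  by (simp_all add: additive_def algebra_simps)

text \<open>The two f-ring axioms together make \<open>x * y\<close> disjoint from itself.\<close>

lemma f_ring_disjoint_mult_eq_0:
  fixes x y :: "'a::f_ring"
  assumes "inf x y = 0"
  shows "x * y = 0"
proof -
  have nonneg: "0 \<le> x" "0 \<le> y" using assms inf_le1 inf_le2 by metis+
  have "inf (x * y) y = 0"
    using assms nonneg(2) by (rule f_ring_right)
  then have "inf y (x * y) = 0"
    by (simp add: inf_commute)
  then have "inf (x * y) (x * y) = 0"
    using nonneg(1) by (rule f_ring_left)
  then show ?thesis by simp
qed

lemma f_ring_disjoint_mult_right:
  fixes a b :: "'a::f_ring"
  assumes "inf a b = 0" "0 \<le> c"
  shows "inf (a * c) (b * c) = 0"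
  using assms by (metis f_ring_right inf_commute)

lemma f_ring_disjoint_mult_left:
  fixes a b :: "'a::f_ring"
  assumes "inf a b = 0" "0 \<le> c"
  shows "inf (c * a) (c * b) = 0"
  using assms by (metis f_ring_left inf_commute)

lemma lattice_hom_mult_right: "0 \<le> c \<Longrightarrow> lattice_hom (\<lambda>x::'a::f_ring. x * c)"
  by (intro lattice_homI_disjoint additive_mult_right f_ring_disjoint_mult_right)

lemma lattice_hom_mult_left: "0 \<le> c \<Longrightarrow> lattice_hom (\<lambda>x::'a::f_ring. c * x)"
  by (intro lattice_homI_disjoint additive_mult_left f_ring_disjoint_mult_left)

text \<open>Squares are positive in an f-ring, because the positive and the negative part of an
  element have product \<open>0\<close>; and \<open>1\<close> is a square.\<close>

lemma unital_f_ring_zero_le_one: "(0::'a::unital_f_ring) \<le> 1"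
proof -
  define p q :: 'a where "p = pprt (1 - 0)" and "q = pprt (0 - 1)"
  have disj: "inf p q = 0" unfolding p_def q_def by (rule pprt_diff_disjoint)
  have "1 = p - q"
    using diff_eq_pprt_diff[of 1 "0::'a"] by (simp add: p_def q_def)
  then have "1 = (p - q) * (p - q)" by simp
  also have "\<dots> = p * p + q * q"
    using disj f_ring_disjoint_mult_eq_0[of p q] f_ring_disjoint_mult_eq_0[of q p]
    by (simp add: algebra_simps inf_commute)
  also have "\<dots> \<ge> 0"
    by (simp add: p_def q_def)
  finally show ?thesis .
qed

text \<open>The axiom speaks of positive elements only; this form applies it to \<open>pprt x\<close>.\<close>

lemma archimedean_nonpos:
  fixes x w :: "'a::archimedean_f_ring"
  assumes "\<And>n. n \<cdot> x \<le> w"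
  shows "x \<le> 0"
proof -
  have "n \<cdot> pprt x \<le> w" for n
    using assms by (intro multiple_pprt_le)
  moreover have "0 \<le> w"
    using assms[of 0] by simp
  ultimately have "pprt x = 0"
    by (intro archimedean[of "pprt x" w]) (simp_all flip: multiple_eq_sum)
  then show ?thesis by (simp add: le_zero_iff_zero_pprt)
qed

text \<open>In a totally ordered ring, either \<open>n \<cdot> u \<le> e\<close>, whence \<open>n \<cdot> (u * e) \<le> e * e\<close>, or
  \<open>e \<le> n \<cdot> u\<close>, whence \<open>n \<cdot> (u * e) \<le> n \<cdot> u * n \<cdot> u = 0\<close>.  So \<open>n \<cdot> (u * e)\<close> is bounded by
  \<open>e * e\<close> in any case.  In an f-ring the two cases become the two summands of
  \<open>n \<cdot> u = inf (n \<cdot> u) e + pprt (n \<cdot> u - e)\<close>.\<close>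

lemma square_zero_annihilates:
  fixes u e :: "'a::archimedean_f_ring"
  assumes u: "0 \<le> u" "u * u = 0" and e: "0 \<le> e"
  shows "u * e = 0"
proof -
  have "n \<cdot> (u * e) \<le> e * e" for n
  proof -
    define p q where "p = pprt (n \<cdot> u - e)" and "q = pprt (e - n \<cdot> u)"
    have p: "0 \<le> p" by (simp add: p_def)
    have "p \<le> n \<cdot> u"
      using u e by (simp add: p_def pprt_def multiple_nonneg diff_le_eq)
    have "p * q = 0"
      unfolding p_def q_def by (intro f_ring_disjoint_mult_eq_0 pprt_diff_disjoint)
    moreover have "n \<cdot> u - e = p - q"
      unfolding p_def q_def by (rule diff_eq_pprt_diff)
    then have "e = n \<cdot> u - p + q"
      by (simp add: algebra_simps)
    ultimately have "p * e = p * n \<cdot> u - p * p"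
      by (simp add: distrib_left right_diff_distrib)
    also have "\<dots> \<le> p * n \<cdot> u"
      using p by simp
    also have "\<dots> \<le> n \<cdot> u * n \<cdot> u"
      using \<open>p \<le> n \<cdot> u\<close> u by (intro mult_right_mono multiple_nonneg)
    also have "\<dots> = 0"
    proof -
      have "u * n \<cdot> u = n \<cdot> (u * u)"
        by (rule additive_multiple[OF additive_mult_left])
      also have "\<dots> = 0"
        using u(2) by (induction n) simp_all
      finally have "u * n \<cdot> u = 0" .
      then have "n \<cdot> (u * n \<cdot> u) = 0"
        by (simp add: multiple_eq_sum)
      then show ?thesis
        by (simp add: multiple_mult_left)
    qed
    finally have pe: "p * e \<le> 0" .
    have "n \<cdot> u - p \<le> e"
      by (simp add: p_def pprt_diff_eq)
    then have "(n \<cdot> u - p) * e \<le> e * e"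
      using e by (rule mult_right_mono)
    then have "n \<cdot> (u * e) \<le> e * e + p * e"
      by (simp add: left_diff_distrib multiple_mult_left diff_le_eq)
    then show ?thesis
      using pe by (meson add_le_same_cancel1 order_trans)
  qed
  then have "u * e \<le> 0"
    by (rule archimedean_nonpos)
  then show ?thesis
    using u e by (simp add: order.antisym)
qed

section \<open>Rigidity of lattice homomorphisms on unital f-rings\<close>

text \<open>Where the tail \<open>p = a - inf a (n \<cdot> 1)\<close> lives, \<open>a\<close> is at least \<open>n \<cdot> 1\<close>; so
  \<open>n \<cdot> p \<le> a * p \<le> a * a\<close>.  Thus truncations approximate \<open>a\<close> with an error of order \<open>1/n\<close>.\<close>

lemma multiple_truncation_error_le:
  fixes a :: "'a::unital_f_ring"
  assumes "0 \<le> a"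
  shows "n \<cdot> (a - inf a (n \<cdot> 1)) \<le> a * a"
proof -
  define p q where "p = pprt (a - n \<cdot> 1)" and "q = pprt (n \<cdot> 1 - a)"
  have p: "0 \<le> p" by (simp add: p_def)
  have "a - n \<cdot> 1 = p - q"
    unfolding p_def q_def by (rule diff_eq_pprt_diff)
  moreover have "q * p = 0"
    unfolding p_def q_def by (intro f_ring_disjoint_mult_eq_0 pprt_diff_disjoint)
  ultimately have "(a - n \<cdot> 1) * p = p * p"
    by (simp add: left_diff_distrib)
  then have "0 \<le> (a - n \<cdot> 1) * p"
    using p by simp
  then have "n \<cdot> p \<le> a * p"
    by (simp add: left_diff_distrib multiple_mult_left)
  also have "p \<le> a"
    using assms by (simp add: p_def pprt_def diff_le_eq multiple_nonneg unital_f_ring_zero_le_one)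
  then have "a * p \<le> a * a"
    using assms by (intro mult_left_mono)
  finally show ?thesis
    by (simp add: p_def pprt_diff_eq)
qed

text \<open>Put \<open>w = S 1 = T 1\<close>.  For every \<open>k\<close> the elements \<open>pprt (n \<cdot> a - k \<cdot> 1)\<close> and
  \<open>pprt (k \<cdot> 1 - n \<cdot> a)\<close> are disjoint.  Applying \<open>S\<close> to the former and \<open>T\<close> to the latter shows
  that no multiple of \<open>w\<close> separates \<open>T (n \<cdot> a)\<close> from \<open>S (n \<cdot> a)\<close>, so \<open>n \<cdot> (S a - T a) \<le> w\<close>.\<close>

lemma hom_le_on_bounded:
  fixes S T :: "'g::unital_f_ring \<Rightarrow> 'k::archimedean_f_ring"
  assumes S: "additive S" "lattice_hom S" and T: "additive T" "lattice_hom T"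
    and unit: "S 1 = T 1"
    and disj: "\<And>x y. inf x y = 0 \<Longrightarrow> inf (S x) (T y) = 0"
    and a: "0 \<le> a" "a \<le> m \<cdot> 1"
  shows "S a \<le> T a"
proof -
  define w where "w = S 1"
  have w: "0 \<le> w"
    unfolding w_def by (intro lattice_hom_nonneg[OF S] unital_f_ring_zero_le_one)
  have "n \<cdot> (S a - T a) \<le> w" for n
  proof -
    have "n \<cdot> a \<le> (n * m) \<cdot> 1"
      using multiple_mono[OF a(2), of n] by (simp add: multiple_multiple)
    then have "S (n \<cdot> a) \<le> (n * m) \<cdot> w" "T (n \<cdot> a) \<le> (n * m) \<cdot> w"
      using lattice_hom_mono[OF S, of "n \<cdot> a" "(n * m) \<cdot> 1"]
        lattice_hom_mono[OF T, of "n \<cdot> a" "(n * m) \<cdot> 1"] unit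
      by (simp_all only: additive_multiple[OF S(1)] additive_multiple[OF T(1)] w_def)
    moreover have "0 \<le> T (n \<cdot> a)"
      using a by (intro lattice_hom_nonneg[OF T] multiple_nonneg)
    moreover have "inf (pprt (S (n \<cdot> a) - k \<cdot> w)) (pprt (k \<cdot> w - T (n \<cdot> a))) = 0" for k
    proof -
      have "inf (S (pprt (n \<cdot> a - k \<cdot> 1))) (T (pprt (k \<cdot> 1 - n \<cdot> a))) = 0"
        by (intro disj pprt_diff_disjoint)
      moreover have "S (k \<cdot> 1) = k \<cdot> w" "T (k \<cdot> 1) = k \<cdot> w"
        using S(1) T(1) unit by (simp_all add: additive_multiple w_def)
      ultimately show ?thesis
        by (simp add: lattice_hom_pprt S T additive.diff[OF S(1)] additive.diff[OF T(1)])
    qed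
    ultimately have "S (n \<cdot> a) - T (n \<cdot> a) \<le> w"
      using w by (intro close_if_no_multiple_between)
    then show ?thesis
      by (simp add: additive_multiple S(1) T(1) multiple_diff)
  qed
  then have "S a - T a \<le> 0"
    by (rule archimedean_nonpos)
  then show ?thesis by simp
qed

text \<open>A general \<open>a\<close> is replaced by its truncations \<open>inf a (n \<cdot> 1)\<close>: their error, multiplied by
  \<open>n\<close>, stays below \<open>a * a\<close>, so the archimedean property removes it.\<close>

lemma hom_le:
  fixes S T :: "'g::unital_f_ring \<Rightarrow> 'k::archimedean_f_ring"
  assumes S: "additive S" "lattice_hom S" and T: "additive T" "lattice_hom T"
    and unit: "S 1 = T 1"
    and disj: "\<And>x y. inf x y = 0 \<Longrightarrow> inf (S x) (T y) = 0"
    and a: "0 \<le> a"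
  shows "S a \<le> T a"
proof -
  have "n \<cdot> (S a - T a) \<le> S (a * a)" for n
  proof -
    define c where "c = inf a (n \<cdot> 1)"
    have c: "0 \<le> c" "c \<le> a" "c \<le> n \<cdot> 1"
      using a by (simp_all add: c_def multiple_nonneg unital_f_ring_zero_le_one)
    have "S c \<le> T c"
      using c by (intro hom_le_on_bounded[OF S T unit disj])
    also have "T c \<le> T a"
      using c by (intro lattice_hom_mono[OF T])
    finally have "n \<cdot> (S a - T a) \<le> n \<cdot> (S a - S c)"
      by (intro multiple_mono diff_mono) simp_all
    also have "\<dots> = S (n \<cdot> (a - c))"
      by (simp add: additive_multiple additive.diff S(1))
    also have "\<dots> \<le> S (a * a)"
      unfolding c_def using a by (intro lattice_hom_mono[OF S] multiple_truncation_error_le)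
    finally show ?thesis .
  qed
  then have "S a - T a \<le> 0"
    by (rule archimedean_nonpos)
  then show ?thesis by simp
qed

lemma hom_determined_by_unit:
  fixes S T :: "'g::unital_f_ring \<Rightarrow> 'k::archimedean_f_ring"
  assumes "additive S" "lattice_hom S" "additive T" "lattice_hom T"
    and unit: "S 1 = T 1"
    and disj: "\<And>x y. inf x y = 0 \<Longrightarrow> inf (S x) (T y) = 0"
  shows "S a = T a"
proof (rule additive_eqI_nonneg[of S T])
  fix a :: 'g
  assume "0 \<le> a"
  have disj': "inf (T x) (S y) = 0" if "inf x y = 0" for x y
    using disj[of y x] that by (simp add: inf_commute)
  show "S a = T a"
  proof (rule order.antisym)
    show "S a \<le> T a"
      by (rule hom_le[OF assms(1-4) unit disj \<open>0 \<le> a\<close>])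
    show "T a \<le> S a"
      by (rule hom_le[OF assms(3,4,1,2) unit[symmetric] disj' \<open>0 \<le> a\<close>])
  qed
qed (rule assms)+

section \<open>Bimorphisms\<close>

lemma l_bimorphism_swap: "l_bimorphism b \<Longrightarrow> l_bimorphism (\<lambda>h g. b g h)"
  by (auto simp: l_bimorphism_def biadditive_def)

text \<open>Different second arguments are harmless: both are dominated by their sum.\<close>

lemma l_bimorphism_disjoint:
  fixes b :: "'g::lattice_ab_group_add \<Rightarrow> 'h::lattice_ab_group_add \<Rightarrow> 'k::lattice_ab_group_add"
  assumes b: "l_bimorphism b" and "inf a a' = 0" and h: "0 \<le> h" "0 \<le> h'"
  shows "inf (b a h) (b a' h') = 0"
proof -
  have homs: "additive (\<lambda>g. b g k)" "additive (\<lambda>k. b g k)"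
    "0 \<le> k \<Longrightarrow> lattice_hom (\<lambda>g. b g k)" "0 \<le> g \<Longrightarrow> lattice_hom (\<lambda>k. b g k)" for g k
    using b by (simp_all add: l_bimorphism_def biadditive_def)
  have nonneg: "0 \<le> a" "0 \<le> a'" using assms(2) inf_le1 inf_le2 by metis+
  have "inf (b a (h + h')) (b a' (h + h')) = 0"
    using lattice_hom_disjoint[OF homs(1) homs(3)] assms(2) h by simp
  moreover have "0 \<le> b a h" "0 \<le> b a' h'"
    using lattice_hom_nonneg[OF homs(2) homs(4)] nonneg h by simp_all
  moreover have "b a h \<le> b a (h + h')" "b a' h' \<le> b a' (h + h')"
    using lattice_hom_mono[OF homs(2) homs(4)] nonneg h by simp_all
  ultimately show ?thesis
    using disjoint_mono by blast
qed

text \<open>The rigidity principle, applied in the variable \<open>a\<close>, reduces the formula to \<open>a = 1\<close>.  With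
  \<open>h = x * y\<close>, \<open>h' = x\<close> and \<open>d = b c y\<close> this is the first step of the reduction; with the
  arguments of \<open>b\<close> swapped it is also the second, which replaces \<open>x\<close> by the unit.\<close>

lemma reduce_left_factor:
  fixes b :: "'g::unital_f_ring \<Rightarrow> 'h::lattice_ab_group_add \<Rightarrow> 'k::archimedean_f_ring"
  assumes b: "l_bimorphism b" and nonneg: "0 \<le> c" "0 \<le> h" "0 \<le> h'" "0 \<le> d"
    and unit: "b c h = b 1 h' * d"
  shows "b (a * c) h = b a h' * d"
proof (rule hom_determined_by_unit[of "\<lambda>a. b (a * c) h" "\<lambda>a. b a h' * d"])
  have homs: "additive (\<lambda>g. b g k)" "0 \<le> k \<Longrightarrow> lattice_hom (\<lambda>g. b g k)" for k
    using b by (simp_all add: l_bimorphism_def biadditive_def)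
  show "additive (\<lambda>a. b (a * c) h)"
    by (rule additive_comp[OF homs(1) additive_mult_right])
  show "lattice_hom (\<lambda>a. b (a * c) h)"
    using nonneg by (intro lattice_hom_comp[OF homs(2) lattice_hom_mult_right])
  show "additive (\<lambda>a. b a h' * d)"
    by (rule additive_comp[OF additive_mult_right homs(1)])
  show "lattice_hom (\<lambda>a. b a h' * d)"
    using nonneg by (intro lattice_hom_comp[OF lattice_hom_mult_right homs(2)])
  show "b (1 * c) h = b 1 h' * d"
    using unit by simp
  fix x y :: 'g
  assume "inf x y = 0"
  then have "inf (b (x * c) h) (b y h') = 0"
    using nonneg by (intro l_bimorphism_disjoint[OF b] f_ring_right)
  then have "inf (b y h') (b (x * c) h) = 0"
    by (simp add: inf_commute)
  then have "inf (b y h' * d) (b (x * c) h) = 0"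
    using nonneg by (intro f_ring_right)
  then show "inf (b (x * c) h) (b y h' * d) = 0"
    by (simp add: inf_commute)
qed

text \<open>Once both left factors are the unit, the formula reads \<open>b c y = b 1 1 * b c y\<close>.  This
  lemma, for \<open>b\<close> and for \<open>b\<close> with its arguments swapped, replaces \<open>c\<close> and \<open>y\<close> by the unit.\<close>

lemma reduce_right_factor:
  fixes b :: "'g::unital_f_ring \<Rightarrow> 'h::lattice_ab_group_add \<Rightarrow> 'k::archimedean_f_ring"
  assumes b: "l_bimorphism b" and nonneg: "0 \<le> h" "0 \<le> d"
    and unit: "b 1 h = d * b 1 h"
  shows "b c h = d * b c h"
proof (rule hom_determined_by_unit[of "\<lambda>c. b c h" "\<lambda>c. d * b c h"])
  have homs: "additive (\<lambda>g. b g h)" "lattice_hom (\<lambda>g. b g h)"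
    using b nonneg by (simp_all add: l_bimorphism_def biadditive_def)
  show "additive (\<lambda>c. b c h)" "lattice_hom (\<lambda>c. b c h)"
    by (rule homs)+
  show "additive (\<lambda>c. d * b c h)"
    by (rule additive_comp[OF additive_mult_left homs(1)])
  show "lattice_hom (\<lambda>c. d * b c h)"
    using nonneg by (intro lattice_hom_comp[OF lattice_hom_mult_left homs(2)])
  show "b 1 h = d * b 1 h"
    by (rule unit)
  fix x y :: 'g
  assume "inf x y = 0"
  then have "inf (b y h) (b x h) = 0"
    using nonneg by (intro l_bimorphism_disjoint[OF b]) (simp_all add: inf_commute)
  then have "inf (d * b y h) (b x h) = 0"
    using nonneg by (intro f_ring_left)
  then show "inf (b x h) (d * b y h) = 0"
    by (simp add: inf_commute)
qed

lemma l_bimorphism_multiplicative: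
  fixes b :: "'g::unital_f_ring \<Rightarrow> 'h::unital_f_ring \<Rightarrow> 'k::archimedean_f_ring"
  assumes b: "l_bimorphism b" and idem: "b 1 1 * b 1 1 = b 1 1"
  shows "b (a * c) (x * y) = b a x * b c y"
proof -
  note swap = l_bimorphism_swap[OF b]
  have homs: "additive (\<lambda>g. b g k)" "additive (\<lambda>k. b g k)"
    "0 \<le> g \<Longrightarrow> lattice_hom (\<lambda>k. b g k)" for g k
    using b by (simp_all add: l_bimorphism_def biadditive_def)
  have nonneg: "0 \<le> b g k" if "0 \<le> g" "0 \<le> k" for g k
    using lattice_hom_nonneg[OF homs(2) homs(3)] that by simp
  have one: "(0::'g) \<le> 1" "(0::'h) \<le> 1"
    by (rule unital_f_ring_zero_le_one)+
  \<comment> \<open>The reductions are undone in the order \<open>y\<close>, \<open>c\<close>, \<open>x\<close>, \<open>a\<close>.\<close>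
  have "b 1 y = b 1 1 * b 1 y" for y
    using reduce_right_factor[OF swap, of 1 "b 1 1" y] idem nonneg one by simp
  then have "b c y = b 1 1 * b c y" if "0 \<le> y" for c y
    using reduce_right_factor[OF b, of y "b 1 1" c] nonneg one that by blast
  then have "b c (x * y) = b 1 x * b c y" if "0 \<le> c" "0 \<le> y" for c x y
    using reduce_left_factor[OF swap, of y c 1 "b c y" x] nonneg one that by blast
  then have pos: "b (a * c) (x * y) = b a x * b c y" if "0 \<le> c" "0 \<le> x" "0 \<le> y" for a c x y
    using reduce_left_factor[OF b, of c "x * y" x "b c y" a] nonneg that by simp
  \<comment> \<open>Both sides are additive in each variable, so the positivity assumptions can be dropped.\<close>
  have pos_cy: "b (a * c) (x * y) = b a x * b c y" if "0 \<le> c" "0 \<le> y" for a c x y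
    by (rule additive_eqI_nonneg[of "\<lambda>x. b (a * c) (x * y)" "\<lambda>x. b a x * b c y"])
      (intro additive_comp[OF homs(2) additive_mult_right]
        additive_comp[OF additive_mult_right homs(2)] pos that)+
  have pos_c: "b (a * c) (x * y) = b a x * b c y" if "0 \<le> c" for a c x y
    by (rule additive_eqI_nonneg[of "\<lambda>y. b (a * c) (x * y)" "\<lambda>y. b a x * b c y"])
      (intro additive_comp[OF homs(2) additive_mult_left]
        additive_comp[OF additive_mult_left homs(2)] pos_cy that)+
  show ?thesis
    by (rule additive_eqI_nonneg[of "\<lambda>c. b (a * c) (x * y)" "\<lambda>c. b a x * b c y"])
      (intro additive_comp[OF homs(1) additive_mult_left]
        additive_comp[OF additive_mult_left homs(1)] pos_c)+
qed

lemma multiplicative_disjoint: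
  fixes b :: "'g::unital_f_ring \<Rightarrow> 'h::unital_f_ring \<Rightarrow> 'k::archimedean_f_ring"
  assumes add: "\<And>g. additive (\<lambda>h. b g h)"
    and pos: "\<And>g h. 0 \<le> g \<Longrightarrow> 0 \<le> h \<Longrightarrow> 0 \<le> b g h"
    and mult: "\<And>a c x y. b (a * c) (x * y) = b a x * b c y"
    and g: "0 \<le> g" and xy: "inf x y = 0"
  shows "inf (b g x) (b g y) = 0"
proof -
  have nonneg: "0 \<le> x" "0 \<le> y" using xy inf_le1 inf_le2 by metis+
  define u where "u = inf (b g x) (b g y)"
  have u: "0 \<le> u" using pos g nonneg by (simp add: u_def)
  have "u * u \<le> b g x * b g y"
    using u pos g nonneg by (intro mult_mono) (simp_all add: u_def)
  also have "\<dots> = b (g * g) (x * y)"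
    by (simp add: mult)
  also have "\<dots> = 0"
    using f_ring_disjoint_mult_eq_0[OF xy] additive.zero[OF add] by simp
  finally have "u * u = 0"
    using u by (simp add: order.antisym)
  have e: "0 \<le> b 1 1"
    by (intro pos unital_f_ring_zero_le_one)
  have "u * b 1 1 = inf (b g x * b 1 1) (b g y * b 1 1)"
    using lattice_hom_mult_right[OF e] by (simp add: u_def lattice_hom_def)
  also have "\<dots> = u"
    by (simp add: u_def flip: mult)
  finally have "u = u * b 1 1" ..
  also have "\<dots> = 0"
    using u \<open>u * u = 0\<close> e by (rule square_zero_annihilates)
  finally show ?thesis by (simp add: u_def)
qed

lemma multiplicative_l_bimorphism:
  fixes b :: "'g::unital_f_ring \<Rightarrow> 'h::unital_f_ring \<Rightarrow> 'k::archimedean_f_ring"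
  assumes b: "biadditive b"
    and pos: "\<And>g h. 0 \<le> g \<Longrightarrow> 0 \<le> h \<Longrightarrow> 0 \<le> b g h"
    and mult: "\<And>a c x y. b (a * c) (x * y) = b a x * b c y"
  shows "l_bimorphism b"
proof -
  have add: "additive (\<lambda>g. b g k)" "additive (\<lambda>k. b g k)" for g k
    using b by (simp_all add: biadditive_def)
  have "lattice_hom (\<lambda>h. b g h)" if "0 \<le> g" for g
    using multiplicative_disjoint[of b, OF add(2) pos mult that]
    by (intro lattice_homI_disjoint add)
  moreover have "lattice_hom (\<lambda>g. b g h)" if "0 \<le> h" for h
    using multiplicative_disjoint[of "\<lambda>h g. b g h", OF add(1) pos mult that]
    by (intro lattice_homI_disjoint add)
  ultimately show ?thesis
    using b by (simp add: l_bimorphism_def)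
qed

theorem theorem3:
  fixes b :: "'g::{archimedean_f_ring,unital_f_ring} \<Rightarrow>
              'h::{archimedean_f_ring,unital_f_ring} \<Rightarrow> 'k::archimedean_f_ring"
  assumes "biadditive b"
    and "\<And>g h. 0 \<le> g \<Longrightarrow> 0 \<le> h \<Longrightarrow> 0 \<le> b g h"
  shows "(\<forall>a c x y. b (a * c) (x * y) = b a x * b c y) \<longleftrightarrow>
         l_bimorphism b \<and> b 1 1 * b 1 1 = b 1 1"
proof
  assume "\<forall>a c x y. b (a * c) (x * y) = b a x * b c y"
  then have mult: "b (a * c) (x * y) = b a x * b c y" for a c x y by blast
  have "b 1 1 * b 1 1 = b 1 1"
    using mult[of 1 1 1 1] by simp
  with multiplicative_l_bimorphism[OF assms mult]
  show "l_bimorphism b \<and> b 1 1 * b 1 1 = b 1 1" by simp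
next
  assume "l_bimorphism b \<and> b 1 1 * b 1 1 = b 1 1"
  then show "\<forall>a c x y. b (a * c) (x * y) = b a x * b c y"
    using l_bimorphism_multiplicative by blast
qed

end
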